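(* Let $f_1\in\mathcal F_{\mu_1,L_1}$ and $f_2\in\mathcal F_{\mu_2,L_2}$ be functions on $\mathbb R^d$ satisfying the standing assumption (A) of the context, and let $F=f_1-f_2$. Assume $L_2\in[0,\mu_1]$, $\mu_1+\mu_2>0$ and $\mu_2\in\big[\frac{-L_2\mu_1}{L_2+\mu_1},L_2\big)$. Let $N\ge1$ and let $x^0,\dots,x^{N+1}$ be generated by $N+1\ge 2$ iterations of DCA started from $x^0\in\operatorname{dom}\partial f_1$. Then $$\frac12\|x^N-x^{N+1}\|^2\;\le\;\frac{F(x^0)-F(x^{N+1})}{\mu_1+\mu_2+\mu_1E_N\!\left(\frac{L_2}{\mu_1}\right)},$$ where $E_N(z)=\sum_{j=1}^{2N}z^{-j}$.
   Context: Function class. For $\mu\in\mathbb R$ and $L\in(\mu,\infty]$, $\mathcal F_{\mu,L}$ denotes the set of proper, lower semicontinuous functions $f:\mathbb R^d\to\mathbb R\cup\{+\infty\}$ such that $f-\frac{\mu}{2}\|\cdot\|^2$ is convex and, if $L<\infty$, $f$ is finite-valued and $\frac L2\|\cdot\|^2-f$ is convex (no condition on the upper curvature if $L=\infty$). Subdifferential. For convex $f$, $\partial f(x)$ is the usual convex subdifferential. For $f\in\mathcal F_{\mu,L}$ with $\mu<0$, $\partial f(x):=\partial\tilde f(x)+\mu x$ where $\tilde f=f-\frac\mu2\|\cdot\|^2$ is convex. $\operatorname{dom}\partial f=\{x:\partial f(x)\ne\emptyset\}$ and $\operatorname{range}\partial f=\bigcup_x\partial f(x)$. Standing assumption (A).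 $f_1\in\mathcal F_{\mu_1,L_1}$ and $f_2\in\mathcal F_{\mu_2,L_2}$ with $0\le\mu_1<L_1\le\infty$, $\mu_2\in(-\infty,\infty)$, $L_2\in(\mu_2,\infty]$; $F=f_1-f_2$ (with the convention $(+\infty)-(+\infty)=+\infty$) is bounded below; $\emptyset\ne\operatorname{dom}\partial f_1\subseteq\operatorname{dom}\partial f_2$ and $\operatorname{range}\partial f_2\subseteq\operatorname{range}\partial f_1$. DCA (difference-of-convex algorithm). Given $x^k$, one iteration selects any $g_2^k\in\partial f_2(x^k)$ and any $x^{k+1}\in\arg\min_{w\in\mathbb R^d}\{f_1(w)-\langle g_2^k,w\rangle\}$. *)

theory Defs
  imports "HOL-Analysis.Analysis"
begin

definition proper_fun :: "('a \<Rightarrow> ereal) \<Rightarrow> bool"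
  where "proper_fun f \<longleftrightarrow> (\<forall>x. f x \<noteq> -\<infinity>) \<and> (\<exists>x. f x \<noteq> \<infinity>)"

definition lsc_fun :: "('a::topological_space \<Rightarrow> ereal) \<Rightarrow> bool"
  where "lsc_fun f \<longleftrightarrow> (\<forall>x. f x \<le> Liminf (at x) f)"

(* Only applied to functions that do not take the value -\<infinity>, so the right-hand side never
   contains an opposite-sign sum of infinities. *)
definition convex_fun :: "('a::real_vector \<Rightarrow> ereal) \<Rightarrow> bool"
  where "convex_fun f \<longleftrightarrow>
    (\<forall>x y. \<forall>u>0. \<forall>v>0. u + v = 1 \<longrightarrow>
      f (u *\<^sub>R x + v *\<^sub>R y) \<le> ereal u * f x + ereal v * f y)"

definition F_class :: "real \<Rightarrow> ereal \<Rightarrow> ('a::euclidean_space \<Rightarrow> ereal) set"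
  where "F_class \<mu> L = {f. proper_fun f \<and> lsc_fun f \<and>
    convex_fun (\<lambda>x. f x - ereal (\<mu> / 2 * (norm x)\<^sup>2)) \<and>
    (L < \<infinity> \<longrightarrow> (\<forall>x. \<bar>f x\<bar> \<noteq> \<infinity>) \<and>
      convex_fun (\<lambda>x. ereal (real_of_ereal L / 2 * (norm x)\<^sup>2) - f x))}"

(* For proper f this set is empty at every x with f x = \<infinity>. *)
definition convex_subdiff :: "('a::euclidean_space \<Rightarrow> ereal) \<Rightarrow> 'a \<Rightarrow> 'a set"
  where "convex_subdiff f x = {g. \<forall>y. f x + ereal (g \<bullet> (y - x)) \<le> f y}"

(* Subdifferential of a member of F_class \<mu> L. If \<mu> < 0 and f happens to be convex, the
   shifted set coincides with convex_subdiff f x. *)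
definition subdiff :: "real \<Rightarrow> ('a::euclidean_space \<Rightarrow> ereal) \<Rightarrow> 'a \<Rightarrow> 'a set"
  where "subdiff \<mu> f x =
    (if \<mu> < 0
     then (\<lambda>g. g + \<mu> *\<^sub>R x) ` convex_subdiff (\<lambda>y. f y - ereal (\<mu> / 2 * (norm y)\<^sup>2)) x
     else convex_subdiff f x)"

definition dom_subdiff :: "real \<Rightarrow> ('a::euclidean_space \<Rightarrow> ereal) \<Rightarrow> 'a set"
  where "dom_subdiff \<mu> f = {x. subdiff \<mu> f x \<noteq> {}}"

definition range_subdiff :: "real \<Rightarrow> ('a::euclidean_space \<Rightarrow> ereal) \<Rightarrow> 'a set"
  where "range_subdiff \<mu> f = (\<Union>x. subdiff \<mu> f x)"

(* The type ereal already has \<infinity> - \<infinity> = \<infinity>, which is the convention used for a difference of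
   two functions with values in \<real> \<union> {\<infinity>}. *)
definition dc_fun :: "('a \<Rightarrow> ereal) \<Rightarrow> ('a \<Rightarrow> ereal) \<Rightarrow> 'a \<Rightarrow> ereal"
  where "dc_fun f1 f2 x = f1 x - f2 x"

definition standing_assumption ::
    "real \<Rightarrow> ereal \<Rightarrow> ('a::euclidean_space \<Rightarrow> ereal) \<Rightarrow> real \<Rightarrow> ereal \<Rightarrow> ('a \<Rightarrow> ereal) \<Rightarrow> bool"
  where "standing_assumption \<mu>\<^sub>1 L\<^sub>1 f1 \<mu>\<^sub>2 L\<^sub>2 f2 \<longleftrightarrow>
    f1 \<in> F_class \<mu>\<^sub>1 L\<^sub>1 \<and> f2 \<in> F_class \<mu>\<^sub>2 L\<^sub>2 \<and>
    0 \<le> \<mu>\<^sub>1 \<and> ereal \<mu>\<^sub>1 < L\<^sub>1 \<and> ereal \<mu>\<^sub>2 < L\<^sub>2 \<and>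
    (\<exists>m::real. \<forall>x. ereal m \<le> dc_fun f1 f2 x) \<and>
    dom_subdiff \<mu>\<^sub>1 f1 \<noteq> {} \<and>
    dom_subdiff \<mu>\<^sub>1 f1 \<subseteq> dom_subdiff \<mu>\<^sub>2 f2 \<and>
    range_subdiff \<mu>\<^sub>2 f2 \<subseteq> range_subdiff \<mu>\<^sub>1 f1"

definition dca_step ::
    "('a::euclidean_space \<Rightarrow> ereal) \<Rightarrow> real \<Rightarrow> ('a \<Rightarrow> ereal) \<Rightarrow> 'a \<Rightarrow> 'a \<Rightarrow> bool"
  where "dca_step f1 \<mu>\<^sub>2 f2 x x' \<longleftrightarrow>
    (\<exists>g \<in> subdiff \<mu>\<^sub>2 f2 x. is_arg_min (\<lambda>w. f1 w - ereal (g \<bullet> w)) (\<lambda>w. True) x')"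

definition E_sum :: "nat \<Rightarrow> real \<Rightarrow> real"
  where "E_sum N z = (\<Sum>j=1..2*N. z powi (- int j))"

end

theory Submission
  imports Defs
begin

text \<open>
  Put \<open>\<Delta>\<^sub>k = x\<^sup>k - x\<^sup>k\<^sup>+\<^sup>1\<close> and \<open>G\<^sub>k = g\<^sub>2\<^sup>k - g\<^sub>2\<^sup>k\<^sup>+\<^sup>1\<close>, where \<open>g\<^sub>2\<^sup>k\<close> is a subgradient of \<open>f\<^sub>2\<close> at \<open>x\<^sup>k\<close>
  and of \<open>f\<^sub>1\<close> at \<open>x\<^sup>k\<^sup>+\<^sup>1\<close>. Strong convexity of \<open>f\<^sub>1\<close> gives \<open>\<mu>\<^sub>1 \<parallel>\<Delta>\<^sub>k\<^sub>+\<^sub>1\<parallel> \<le> \<parallel>G\<^sub>k\<parallel>\<close>, and the interpolation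
  inequality for \<open>f\<^sub>2\<close> gives \<open>\<parallel>G\<^sub>k\<parallel> \<le> L\<^sub>2 \<parallel>\<Delta>\<^sub>k\<parallel>\<close>, so the steps contract by the factor \<open>L\<^sub>2 / \<mu>\<^sub>1\<close>.
  The same inequalities bound the decrease of \<open>F\<close> in step \<open>k\<close> below by
  \<open>(\<mu>\<^sub>1 + L\<^sub>2) / (2 L\<^sub>2\<^sup>2) \<parallel>G\<^sub>k\<parallel>\<^sup>2\<close>; this is where the lower bound on \<open>\<mu>\<^sub>2\<close> enters. Summing these
  decreases for \<open>k < N\<close>, expressed through \<open>\<parallel>\<Delta>\<^sub>N\<parallel>\<close> by the contraction, yields the geometric sum;
  the last step contributes only the plain descent \<open>(\<mu>\<^sub>1 + \<mu>\<^sub>2) / 2 \<parallel>\<Delta>\<^sub>N\<parallel>\<^sup>2\<close>.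
\<close>

section \<open>Quadratic bounds from convexity and subgradients\<close>

lemma le_of_le_add_small_multiple:
  fixes A B C :: real
  assumes "\<And>t. 0 < t \<Longrightarrow> t < 1 \<Longrightarrow> A \<le> B + t * C"
  shows "A \<le> B"
proof (rule tendsto_lowerbound)
  have "((\<lambda>t. B + t * C) \<longlongrightarrow> B + 0 * C) (at_right 0)"
    by (intro tendsto_intros)
  then show "((\<lambda>t. B + t * C) \<longlongrightarrow> B) (at_right 0)" by simp
  show "\<forall>\<^sub>F t in at_right 0. A \<le> B + t * C"
    unfolding eventually_at_right_field using assms by (intro exI[of _ 1]) auto
qed simp

lemma norm_sq_convex_combination:
  fixes x y :: "'a::real_inner"
  shows "(norm ((1 - t) *\<^sub>R x + t *\<^sub>R y))\<^sup>2
    = (1 - t) * (norm x)\<^sup>2 + t * (norm y)\<^sup>2 - t * (1 - t) * (norm (y - x))\<^sup>2"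
  unfolding power2_norm_eq_inner
  by (simp add: inner_simps inner_commute algebra_simps)

text \<open>At a point of the segment from \<open>x\<close> to \<open>y\<close>, convexity of the
  shifted function bounds \<open>f\<close> from above and the subgradient bounds it from below.
  Dividing by \<open>t\<close> and letting \<open>t\<close> tend to 0 gives the claim.\<close>

lemma strong_convexity_subgradient:
  fixes f :: "'a::euclidean_space \<Rightarrow> ereal"
  assumes conv: "convex_fun (\<lambda>x. f x - ereal (\<mu> / 2 * (norm x)\<^sup>2))"
    and g: "g \<in> convex_subdiff f x" and fx: "f x = ereal a" and fy: "f y = ereal b"
  shows "a + g \<bullet> (y - x) + \<mu> / 2 * (norm (y - x))\<^sup>2 \<le> b"
proof (rule le_of_le_add_small_multiple)
  fix t :: real assume t: "0 < t" "t < 1"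
  define z where "z = (1 - t) *\<^sub>R x + t *\<^sub>R y"
  have up: "f z - ereal (\<mu> / 2 * (norm z)\<^sup>2)
     \<le> ereal ((1 - t) * (a - \<mu> / 2 * (norm x)\<^sup>2) + t * (b - \<mu> / 2 * (norm y)\<^sup>2))"
    using conv[unfolded convex_fun_def, rule_format, of "1 - t" t x y] t
    by (simp add: fx fy z_def)
  have lo: "ereal (a + g \<bullet> (z - x)) \<le> f z"
    using g by (auto simp: convex_subdiff_def fx)
  obtain c where c: "f z = ereal c"
    using up lo by (cases "f z") auto
  have c1: "c - \<mu> / 2 * (norm z)\<^sup>2
      \<le> (1 - t) * (a - \<mu> / 2 * (norm x)\<^sup>2) + t * (b - \<mu> / 2 * (norm y)\<^sup>2)"
    using up by (simp add: c)
  have "z - x = t *\<^sub>R (y - x)" by (simp add: z_def algebra_simps)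
  then have c2: "a + t * (g \<bullet> (y - x)) \<le> c" using lo by (simp add: c)
  have "t * (a + g \<bullet> (y - x) + \<mu> / 2 * (norm (y - x))\<^sup>2)
      \<le> t * (b + t * (\<mu> / 2 * (norm (y - x))\<^sup>2))"
    using c1 c2 unfolding z_def norm_sq_convex_combination
    by (simp add: algebra_simps diff_divide_distrib add_divide_distrib)
  then show "a + g \<bullet> (y - x) + \<mu> / 2 * (norm (y - x))\<^sup>2 \<le> b + t * (\<mu> / 2 * (norm (y - x))\<^sup>2)"
    using t by simp
qed

lemma subdiff_lower_bound:
  fixes f :: "'a::euclidean_space \<Rightarrow> ereal"
  assumes conv: "convex_fun (\<lambda>x. f x - ereal (\<mu> / 2 * (norm x)\<^sup>2))"
    and g: "g \<in> subdiff \<mu> f x" and fx: "f x = ereal a" and fy: "f y = ereal b"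
  shows "a + g \<bullet> (y - x) + \<mu> / 2 * (norm (y - x))\<^sup>2 \<le> b"
proof (cases "\<mu> < 0")
  case True
  then obtain h where h: "g = h + \<mu> *\<^sub>R x"
    "h \<in> convex_subdiff (\<lambda>y. f y - ereal (\<mu> / 2 * (norm y)\<^sup>2)) x"
    using g by (auto simp: subdiff_def)
  have "(a - \<mu> / 2 * (norm x)\<^sup>2) + h \<bullet> (y - x) \<le> b - \<mu> / 2 * (norm y)\<^sup>2"
    using h(2) fx fy unfolding convex_subdiff_def by (auto dest!: spec[of _ y])
  then show ?thesis
    by (simp add: h(1) power2_norm_eq_inner inner_simps inner_commute algebra_simps)
next
  case False
  then show ?thesis
    using strong_convexity_subgradient[OF conv _ fx fy] g by (simp add: subdiff_def)
qed

lemma convex_on_if_convex_fun: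
  assumes "convex_fun (\<lambda>x. ereal (c x))"
  shows "convex_on UNIV c"
  by (rule convex_onI) (use assms in \<open>auto simp: convex_fun_def\<close>)

text \<open>Since \<open>x\<close> lies between \<open>y\<close> and the point \<open>w\<close> just
  beyond \<open>x\<close>, convexity bounds \<open>c y\<close> from below in terms of
  \<open>c x\<close> and \<open>c w\<close>; inserting the upper bound at \<open>w\<close> costs
  only an error of order \<open>t\<close>.\<close>

lemma convex_on_subgradient_if_quadratic_upper_bound:
  fixes c :: "'a::real_inner \<Rightarrow> real"
  assumes conv: "convex_on UNIV c"
    and up: "\<And>y. c y \<le> c x + p \<bullet> (y - x) + K * (norm (y - x))\<^sup>2"
  shows "c x + p \<bullet> (y - x) \<le> c y"
proof (rule le_of_le_add_small_multiple)
  fix t :: real assume t: "0 < t" "t < 1"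
  define w where "w = x - t *\<^sub>R (y - x)"
  have sum1: "1 / (1 + t) + t / (1 + t) = 1"
    using t by (simp add: field_simps)
  have "(1 / (1 + t)) *\<^sub>R w + (t / (1 + t)) *\<^sub>R y = (1 / (1 + t) + t / (1 + t)) *\<^sub>R x"
    by (simp add: w_def algebra_simps)
  then have "(1 / (1 + t)) *\<^sub>R w + (t / (1 + t)) *\<^sub>R y = x"
    unfolding sum1 by simp
  moreover have "c ((1 / (1 + t)) *\<^sub>R w + (t / (1 + t)) *\<^sub>R y)
      \<le> 1 / (1 + t) * c w + t / (1 + t) * c y"
    using conv t sum1 unfolding convex_on_def
    by (meson UNIV_I add_pos_pos divide_nonneg_pos less_imp_le zero_le_one zero_less_one)
  ultimately have "c x \<le> 1 / (1 + t) * c w + t / (1 + t) * c y" by simp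
  also have "\<dots> = (c w + t * c y) / (1 + t)" by (simp add: add_divide_distrib)
  finally have 1: "(1 + t) * c x \<le> c w + t * c y"
    using t by (simp add: pos_le_divide_eq mult.commute)
  have 2: "c w \<le> c x - t * (p \<bullet> (y - x)) + K * (t\<^sup>2 * (norm (y - x))\<^sup>2)"
    using up[of w] by (simp add: w_def power_mult_distrib)
  have "t * (c x + p \<bullet> (y - x)) \<le> t * (c y + t * (K * (norm (y - x))\<^sup>2))"
    using 1 2 by (simp add: algebra_simps power2_eq_square)
  then show "c x + p \<bullet> (y - x) \<le> c y + t * (K * (norm (y - x))\<^sup>2)"
    using t by simp
qed

lemma quadratic_bounds_interpolation:
  fixes \<phi> :: "'a::real_inner \<Rightarrow> real"
  assumes mL: "m < L"
    and lower: "\<And>z. \<phi> y + gy \<bullet> (z - y) + m / 2 * (norm (z - y))\<^sup>2 \<le> \<phi> z"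
    and upper: "\<And>z. \<phi> z \<le> \<phi> x + gx \<bullet> (z - x) + L / 2 * (norm (z - x))\<^sup>2"
  shows "\<phi> y + gy \<bullet> (x - y) + m / 2 * (norm (x - y))\<^sup>2
    + (norm (gx - gy - m *\<^sub>R (x - y)))\<^sup>2 / (2 * (L - m)) \<le> \<phi> x"
proof -
  define d where "d = x - y"
  define w where "w = gx - gy - m *\<^sub>R d"
  define e where "e = (1 / (L - m)) *\<^sub>R w"
  have w: "w = (L - m) *\<^sub>R e" using mL by (simp add: e_def)
  have gx: "gx = gy + m *\<^sub>R d + (L - m) *\<^sub>R e" by (simp flip: w) (simp add: w_def)
  have z: "(x - e) - y = d - e" "(x - e) - x = - e" by (simp_all add: d_def)
  \<comment> \<open>\<open>x - e\<close> minimises the gap between the quadratic majorant at \<open>x\<close> and the minorant at \<open>y\<close>.\<close>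
  have "\<phi> y + gy \<bullet> (d - e) + m / 2 * (norm (d - e))\<^sup>2
      \<le> \<phi> x + gx \<bullet> (- e) + L / 2 * (norm e)\<^sup>2"
    using lower[of "x - e"] upper[of "x - e"] unfolding z by simp
  then have "\<phi> y + gy \<bullet> d + m / 2 * (norm d)\<^sup>2 + (L - m) / 2 * (e \<bullet> e) \<le> \<phi> x"
    unfolding gx
    by (simp add: power2_norm_eq_inner inner_simps inner_commute algebra_simps diff_divide_distrib add_divide_distrib)
  moreover have "M * (M * q) / (2 * M) = M / 2 * q" if "M \<noteq> 0" for M q :: real
    using that by simp
  from this[of "L - m" "e \<bullet> e"] have "(norm w)\<^sup>2 / (2 * (L - m)) = (L - m) / 2 * (e \<bullet> e)"
    using mL unfolding w power2_norm_eq_inner inner_scaleR_left inner_scaleR_right by simp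
  ultimately show ?thesis unfolding w_def d_def by linarith
qed

text \<open>In the next two lemmas \<open>A\<close>, \<open>B\<close>, \<open>P\<close> stand for \<open>\<parallel>\<Delta>\<parallel>\<^sup>2\<close>, \<open>\<parallel>G\<parallel>\<^sup>2\<close>, \<open>G \<bullet> \<Delta>\<close>; then \<open>S\<close> is the
  symmetrised interpolation inequality and \<open>R\<close> is \<open>\<parallel>L \<Delta> - G\<parallel>\<^sup>2 \<ge> 0\<close>.\<close>

lemma gradient_difference_bound:
  fixes A B P L m :: real
  assumes S: "B + m * L * A \<le> (L + m) * P" and R: "0 \<le> L\<^sup>2 * A - 2 * L * P + B"
    and "0 \<le> L" "0 \<le> L + m" "m < L"
  shows "B \<le> L\<^sup>2 * A"
proof -
  have S': "0 \<le> (L + m) * P - B - m * L * A" using S by simp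
  \<comment> \<open>The weights \<open>2 * L\<close> and \<open>L + m\<close> make \<open>P\<close>
    cancel; what remains has the factor \<open>L - m\<close>.\<close>
  have "0 \<le> 2 * L * ((L + m) * P - B - m * L * A) + (L + m) * (L\<^sup>2 * A - 2 * L * P + B)"
    by (rule add_nonneg_nonneg[OF mult_nonneg_nonneg[OF _ S'] mult_nonneg_nonneg[OF _ R]])
      (use assms in auto)
  also have "\<dots> = (L - m) * (L\<^sup>2 * A - B)"
    by (simp add: algebra_simps power2_eq_square)
  finally show ?thesis using \<open>m < L\<close> by (auto simp: zero_le_mult_iff)
qed

lemma descent_bound:
  fixes A B P L m \<mu> :: real
  assumes S: "B + m * L * A \<le> (L + m) * P" and R: "0 \<le> L\<^sup>2 * A - 2 * L * P + B"
    and "0 < L" "0 \<le> \<mu>" "m < L" and m: "0 \<le> \<mu> * L + \<mu> * m + m * L"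
  shows "(\<mu> + L) / L\<^sup>2 * B \<le> (\<mu> + m) * A + (B - 2 * m * P + m\<^sup>2 * A) / (L - m)"
proof -
  define T where "T = (B - 2 * m * P + m\<^sup>2 * A) / (L - m)"
  have T: "(L - m) * T = B - 2 * m * P + m\<^sup>2 * A" using \<open>m < L\<close> by (simp add: T_def)
  have S': "0 \<le> (L + m) * P - B - m * L * A" using S by simp
  \<comment> \<open>The weights give \<open>P\<close> the coefficient
    \<open>- 2 * m * L\<^sup>2\<close> that it has in the claim cleared of denominators; the second
    weight is nonnegative by \<open>m\<close>.\<close>
  have "0 \<le> 2 * \<mu> * L * ((L + m) * P - B - m * L * A)
      + (\<mu> * L + \<mu> * m + m * L) * (L\<^sup>2 * A - 2 * L * P + B)"
    by (rule add_nonneg_nonneg[OF mult_nonneg_nonneg[OF _ S'] mult_nonneg_nonneg[OF _ R]])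
      (use assms in auto)
  also have "\<dots> = (L - m) * (L\<^sup>2 * ((\<mu> + m) * A) - (\<mu> + L) * B)
      + L\<^sup>2 * (B - 2 * m * P + m\<^sup>2 * A)"
    by (simp add: algebra_simps power2_eq_square)
  also have "\<dots> = (L - m) * (L\<^sup>2 * ((\<mu> + m) * A + T) - (\<mu> + L) * B)"
    unfolding T[symmetric] by (simp add: algebra_simps)
  finally have "(\<mu> + L) * B \<le> L\<^sup>2 * ((\<mu> + m) * A + T)"
    using \<open>m < L\<close> by (auto simp: zero_le_mult_iff)
  then show ?thesis
    using \<open>0 < L\<close> unfolding T_def[symmetric] by (simp add: field_simps)
qed

text \<open>Induction on \<open>n\<close>: the contraction turns the old sum at \<open>D n\<close>
  into \<open>w\<^sup>2\<close> times that sum at \<open>D (Suc n)\<close>, shifting all exponents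
  by 2, and the new decrease supplies the missing powers \<open>w + w\<^sup>2\<close>.\<close>

lemma contraction_descent_sum:
  fixes D F :: "nat \<Rightarrow> real" and w c :: real
  assumes "0 \<le> w" "0 \<le> c"
    and "\<And>k. k < n \<Longrightarrow> w\<^sup>2 * D (Suc k) \<le> D k"
    and "\<And>k. k < n \<Longrightarrow> c * (w + w\<^sup>2) * D (Suc k) \<le> F k - F (Suc k)"
  shows "c * (\<Sum>j=1..2 * n. w ^ j) * D n \<le> F 0 - F n"
  using assms(3,4)
proof (induction n)
  case (Suc n)
  define s where "s = (\<Sum>j=1..2 * n. w ^ j)"
  have "(\<Sum>j=1..2 * Suc n. w ^ j) = w + w\<^sup>2 + (\<Sum>j=3..2 * n + 2. w ^ j)"
    by (simp add: sum.atLeast_Suc_atMost numeral_eq_Suc)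
  also have "(\<Sum>j=3..2 * n + 2. w ^ j) = (\<Sum>j=1..2 * n. w ^ (j + 2))"
    using sum.shift_bounds_cl_nat_ivl[of "\<lambda>j. w ^ j" 1 2 "2 * n"] by (simp add: numeral_eq_Suc)
  also have "\<dots> = w\<^sup>2 * s"
    by (simp add: s_def sum_distrib_left power_add power2_eq_square mult.assoc)
  finally have sum: "(\<Sum>j=1..2 * Suc n. w ^ j) = w + w\<^sup>2 + w\<^sup>2 * s" .
  have "0 \<le> c * s"
    using assms(1,2) by (simp add: s_def sum_nonneg)
  then have "c * s * (w\<^sup>2 * D (Suc n)) \<le> c * s * D n"
    using Suc.prems(1)[of n] by (intro mult_left_mono) auto
  also have "\<dots> \<le> F 0 - F n"
    unfolding s_def using Suc by simp
  finally show ?case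
    using Suc.prems(2)[of n] unfolding sum by (simp add: algebra_simps)
qed simp

theorem theorem2:
  fixes f1 f2 :: "real ^ 'n \<Rightarrow> ereal"
    and \<mu>\<^sub>1 \<mu>\<^sub>2 L\<^sub>2 :: real and L\<^sub>1 :: ereal
    and N :: nat and x :: "nat \<Rightarrow> real ^ 'n"
  assumes "standing_assumption \<mu>\<^sub>1 L\<^sub>1 f1 \<mu>\<^sub>2 (ereal L\<^sub>2) f2"
    and "0 \<le> L\<^sub>2" and "L\<^sub>2 \<le> \<mu>\<^sub>1"
    and "\<mu>\<^sub>1 + \<mu>\<^sub>2 > 0"
    and "- L\<^sub>2 * \<mu>\<^sub>1 / (L\<^sub>2 + \<mu>\<^sub>1) \<le> \<mu>\<^sub>2" and "\<mu>\<^sub>2 < L\<^sub>2"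
    and "N \<ge> 1"
    and "x 0 \<in> dom_subdiff \<mu>\<^sub>1 f1"
    and "\<And>k. k \<le> N \<Longrightarrow> dca_step f1 \<mu>\<^sub>2 f2 (x k) (x (Suc k))"
  shows "ereal (1 / 2 * (norm (x N - x (N + 1)))\<^sup>2)
    \<le> (dc_fun f1 f2 (x 0) - dc_fun f1 f2 (x (N + 1)))
        / ereal (\<mu>\<^sub>1 + \<mu>\<^sub>2 + \<mu>\<^sub>1 * E_sum N (L\<^sub>2 / \<mu>\<^sub>1))"
proof -

  \<comment> \<open>Signs of the parameters\<close>
  define \<mu> m L where "\<mu> = \<mu>\<^sub>1" and "m = \<mu>\<^sub>2" and "L = L\<^sub>2"
  note defs = \<mu>_def m_def L_def
  \<comment> \<open>For \<open>L\<^sub>2 = 0\<close> the lower bound on \<open>\<mu>\<^sub>2\<close>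
    is 0, contradicting \<open>\<mu>\<^sub>2 < L\<^sub>2\<close>.\<close>
  have L: "0 < L"
  proof (rule ccontr)
    assume "\<not> 0 < L"
    then have "L\<^sub>2 = 0" using assms(2) by (simp add: L_def)
    then show False using assms(5,6) by simp
  qed
  have mu: "0 < \<mu>" "L \<le> \<mu>" using L assms(3) by (auto simp: defs)
  have mL: "m < L" using assms(6) by (simp add: defs)
  have m: "0 \<le> \<mu> * L + \<mu> * m + m * L"
  proof -
    have "- L * \<mu> \<le> m * (L + \<mu>)"
      using assms(5) L mu by (simp only: defs pos_divide_le_eq[OF add_pos_pos])
    then show ?thesis by (simp add: algebra_simps)
  qed
  have Lm: "0 \<le> L + m"
  proof (rule ccontr)
    assume "\<not> 0 \<le> L + m"
    then have "\<mu> * (L + m) < 0" "m * L < 0" using mu L by (auto simp: mult_less_0_iff)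
    then show False using m by (simp add: algebra_simps)
  qed

  \<comment> \<open>Finite values and subgradients along the iterates\<close>
  have f1: "proper_fun f1" "convex_fun (\<lambda>x. f1 x - ereal (\<mu> / 2 * (norm x)\<^sup>2))"
    using assms(1) by (auto simp: standing_assumption_def F_class_def defs)
  have f2: "convex_fun (\<lambda>x. f2 x - ereal (m / 2 * (norm x)\<^sup>2))" "\<And>x. \<bar>f2 x\<bar> \<noteq> \<infinity>"
    "convex_fun (\<lambda>x. ereal (L / 2 * (norm x)\<^sup>2) - f2 x)"
    using assms(1) by (auto simp: standing_assumption_def F_class_def defs)

  define \<phi> where "\<phi> y = real_of_ereal (f2 y)" for y
  have \<phi>: "f2 y = ereal (\<phi> y)" for y
    using f2(2)[of y] by (auto simp: \<phi>_def)
  \<comment> \<open>\<open>real_of_ereal\<close> sends infinities to 0, so \<open>a k\<close>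
    represents \<open>f1 (x k)\<close> only once finiteness is known: from minimality for later
    iterates, from the nonempty subdifferential for \<open>x 0\<close>.\<close>
  define a where "a k = real_of_ereal (f1 (x k))" for k

  have "\<exists>g. \<forall>k\<le>N. g k \<in> subdiff m f2 (x k) \<and>
      is_arg_min (\<lambda>w. f1 w - ereal (g k \<bullet> w)) (\<lambda>w. True) (x (Suc k))"
  proof -
    have "\<forall>k. \<exists>g. k \<le> N \<longrightarrow> g \<in> subdiff m f2 (x k) \<and>
        is_arg_min (\<lambda>w. f1 w - ereal (g \<bullet> w)) (\<lambda>w. True) (x (Suc k))"
      using assms(9) by (auto simp: dca_step_def m_def)
    then show ?thesis by metis
  qed
  then obtain g where g2: "\<And>k. k \<le> N \<Longrightarrow> g k \<in> subdiff m f2 (x k)"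
    and "\<And>k. k \<le> N \<Longrightarrow> is_arg_min (\<lambda>w. f1 w - ereal (g k \<bullet> w)) (\<lambda>w. True) (x (Suc k))"
    by blast
  then have min: "f1 (x (Suc k)) - ereal (g k \<bullet> x (Suc k)) \<le> f1 w - ereal (g k \<bullet> w)"
    if "k \<le> N" for k w
    using that by (auto simp: is_arg_min_def not_less)

  obtain y0 b0 where y0: "f1 y0 = ereal b0"
    using f1(1) unfolding proper_fun_def by (metis ereal_cases)
  have fin: "f1 (x (Suc k)) = ereal (a (Suc k))" if "k \<le> N" for k
    using min[OF that, of y0] f1(1) y0
    by (cases "f1 (x (Suc k))") (auto simp: a_def proper_fun_def)
  obtain h where "h \<in> convex_subdiff f1 (x 0)"
    using assms(8) mu by (auto simp: dom_subdiff_def subdiff_def defs)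
  then have "f1 (x 0) + ereal (h \<bullet> (y0 - x 0)) \<le> ereal b0"
    unfolding convex_subdiff_def y0[symmetric] by blast
  then have fin0: "f1 (x 0) = ereal (a 0)"
    using f1(1) by (cases "f1 (x 0)") (auto simp: a_def proper_fun_def)
  have a: "f1 (x k) = ereal (a k)" if "k \<le> Suc N" for k
    using fin fin0 that by (cases k) auto
  have g1: "g k \<in> convex_subdiff f1 (x (Suc k))" if "k \<le> N" for k
  proof -
    have "f1 (x (Suc k)) + ereal (g k \<bullet> (y - x (Suc k))) \<le> f1 y" for y
      using min[OF that, of y] fin[OF that]
      by (cases "f1 y") (auto simp: inner_diff_right)
    then show ?thesis by (simp add: convex_subdiff_def)
  qed

  \<comment> \<open>Quadratic bounds for both functions at the iterates\<close>
  have f1_lower: "a (Suc k) + g k \<bullet> (x j - x (Suc k)) + \<mu> / 2 * (norm (x j - x (Suc k)))\<^sup>2 \<le> a j"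
    if "k \<le> N" "j \<le> Suc N" for j k
    using strong_convexity_subgradient[OF f1(2) g1[OF that(1)] fin[OF that(1)] a[OF that(2)]] .
  have f2_lower: "\<phi> (x k) + g k \<bullet> (y - x k) + m / 2 * (norm (y - x k))\<^sup>2 \<le> \<phi> y"
    if "k \<le> N" for k y
    using subdiff_lower_bound[OF f2(1) g2[OF that] \<phi> \<phi>] .
  \<comment> \<open>By \<open>f2_lower\<close> the convex function \<open>c\<close> lies below a
    quadratic touching it at \<open>x k\<close>, so the slope there is a subgradient of
    \<open>c\<close>; rewritten for \<open>\<phi>\<close> this is the upper bound.\<close>
  have f2_upper: "\<phi> y \<le> \<phi> (x k) + g k \<bullet> (y - x k) + L / 2 * (norm (y - x k))\<^sup>2"
    if "k \<le> N" for k y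
  proof -
    define c where "c y = L / 2 * (norm y)\<^sup>2 - \<phi> y" for y
    have "convex_on UNIV c"
      by (rule convex_on_if_convex_fun) (use f2(3) in \<open>simp add: \<phi> c_def\<close>)
    moreover have
      "c y \<le> c (x k) + (L *\<^sub>R x k - g k) \<bullet> (y - x k) + (L - m) / 2 * (norm (y - x k))\<^sup>2" for y
      using f2_lower[OF that, of y]
      by (simp add: c_def power2_norm_eq_inner inner_simps inner_commute algebra_simps
          diff_divide_distrib add_divide_distrib)
    ultimately have "c (x k) + (L *\<^sub>R x k - g k) \<bullet> (y - x k) \<le> c y"
      by (rule convex_on_subgradient_if_quadratic_upper_bound)
    then show ?thesis
      by (simp add: c_def power2_norm_eq_inner inner_simps inner_commute algebra_simps
          diff_divide_distrib add_divide_distrib)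
  qed
  note interp = quadratic_bounds_interpolation[OF mL f2_lower f2_upper]

  \<comment> \<open>Inequalities for a single step\<close>
  define d where "d k = x k - x (Suc k)" for k
  define G where "G k = g k - g (Suc k)" for k
  define F where "F k = a k - \<phi> (x k)" for k
  define D where "D k = (norm (d k))\<^sup>2" for k

  \<comment> \<open>Only \<open>k < N\<close> is possible: \<open>G k\<close> involves
    \<open>g (Suc k)\<close>, and subgradients are chosen only up to index \<open>N\<close>.\<close>
  have S: "G k \<bullet> G k + m * L * D k \<le> (L + m) * (G k \<bullet> d k)"
    and desc: "(\<mu> + m) * D k + (G k \<bullet> G k - 2 * m * (G k \<bullet> d k) + m\<^sup>2 * D k) / (L - m)
      \<le> 2 * (F k - F (Suc k))" if k: "k < N" for k
  proof -
    define W where "W = (norm (G k - m *\<^sub>R d k))\<^sup>2"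
    have W: "W = G k \<bullet> G k - 2 * m * (G k \<bullet> d k) + m\<^sup>2 * D k"
      unfolding W_def D_def power2_norm_eq_inner
      by (simp add: inner_simps inner_commute algebra_simps power2_eq_square)
    have neg: "x (Suc k) - x k = - d k" by (simp add: d_def)
    have "g (Suc k) - g k - m *\<^sub>R (x (Suc k) - x k) = - (G k - m *\<^sub>R d k)"
      by (simp add: G_def neg)
    then have W': "(norm (g (Suc k) - g k - m *\<^sub>R (x (Suc k) - x k)))\<^sup>2 = W"
      by (simp add: W_def norm_minus_commute)
    define V where "V = W / (L - m)"
    have V: "W / (2 * (L - m)) = V / 2" by (simp add: V_def mult.commute)
    \<comment> \<open>Interpolation in both orders: the sum of \<open>i1\<close> and
      \<open>i2\<close> gives \<open>S\<close>, while \<open>i2\<close> with strong convexity of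
      \<open>f1\<close> gives \<open>desc\<close>.\<close>
    have i1: "\<phi> (x (Suc k)) + g (Suc k) \<bullet> d k + m / 2 * D k + V / 2 \<le> \<phi> (x k)"
      using interp[of "Suc k" k] k unfolding V[symmetric] by (simp add: W_def D_def G_def d_def)
    have i2: "\<phi> (x k) - g k \<bullet> d k + m / 2 * D k + V / 2 \<le> \<phi> (x (Suc k))"
      using interp[of k "Suc k"] k unfolding W' V by (simp add: D_def neg)
    have "m * D k + W / (L - m) \<le> G k \<bullet> d k"
      using i1 i2 by (simp add: G_def inner_diff_left flip: V_def)
    then have "W \<le> (L - m) * (G k \<bullet> d k - m * D k)"
      using mL by (simp add: field_simps)
    then show "G k \<bullet> G k + m * L * D k \<le> (L + m) * (G k \<bullet> d k)"
      unfolding W by (simp add: algebra_simps power2_eq_square)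
    have "a (Suc k) + g k \<bullet> d k + \<mu> / 2 * D k \<le> a k"
      using f1_lower[of k k] k by (simp add: d_def D_def)
    then have "(\<mu> + m) * D k + W / (L - m) \<le> 2 * (F k - F (Suc k))"
      using i2 by (simp add: F_def algebra_simps flip: V_def)
    then show "(\<mu> + m) * D k + (G k \<bullet> G k - 2 * m * (G k \<bullet> d k) + m\<^sup>2 * D k) / (L - m)
      \<le> 2 * (F k - F (Suc k))" unfolding W .
  qed
  have R: "0 \<le> L\<^sup>2 * D k - 2 * L * (G k \<bullet> d k) + G k \<bullet> G k" for k
  proof -
    have "0 \<le> (L *\<^sub>R d k - G k) \<bullet> (L *\<^sub>R d k - G k)" by simp
    then show ?thesis
      unfolding D_def power2_norm_eq_inner
      by (simp add: inner_simps inner_commute algebra_simps power2_eq_square)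
  qed
  have G_le: "G k \<bullet> G k \<le> L\<^sup>2 * D k" if "k < N" for k
    using gradient_difference_bound[OF S[OF that] R] L Lm mL by simp
  have F_ge: "(\<mu> + L) / L\<^sup>2 * (G k \<bullet> G k) \<le> 2 * (F k - F (Suc k))" if "k < N" for k
    using descent_bound[OF S[OF that] R L _ mL m] desc[OF that] mu by linarith
  \<comment> \<open>Strong monotonicity of the subgradients of \<open>f1\<close>: \<open>g k\<close>
    belongs to \<open>x (Suc k)\<close>, hence the shifted index in
    \<open>d (Suc k)\<close>.\<close>
  have G_ge: "\<mu>\<^sup>2 * D (Suc k) \<le> G k \<bullet> G k" if k: "k < N" for k
  proof -
    have "\<mu> * D (Suc k) \<le> G k \<bullet> d (Suc k)"
      using f1_lower[of k "Suc (Suc k)"] f1_lower[of "Suc k" "Suc k"] k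
      by (simp add: D_def G_def d_def power2_norm_eq_inner inner_simps inner_commute algebra_simps)
    also have "\<dots> \<le> norm (G k) * norm (d (Suc k))" by (rule norm_cauchy_schwarz)
    finally have "\<mu> * norm (d (Suc k)) * norm (d (Suc k)) \<le> norm (G k) * norm (d (Suc k))"
      by (simp add: D_def power2_eq_square)
    then have "\<mu> * norm (d (Suc k)) \<le> norm (G k)"
      by (cases "d (Suc k) = 0") simp_all
    then have "(\<mu> * norm (d (Suc k)))\<^sup>2 \<le> (norm (G k))\<^sup>2"
      using mu by (intro power_mono) auto
    then show ?thesis by (simp add: D_def power_mult_distrib power2_norm_eq_inner)
  qed

  \<comment> \<open>Summation over the steps\<close>
  define w where "w = \<mu> / L"
  have w: "0 < w" using mu L by (simp add: w_def)
  have "\<mu> / 2 * (\<Sum>j=1..2 * N. w ^ j) * D N \<le> F 0 - F N"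
  proof (rule contraction_descent_sum)
    fix k assume k: "k < N"
    have "\<mu>\<^sup>2 * D (Suc k) \<le> L\<^sup>2 * D k" using G_le[OF k] G_ge[OF k] by simp
    then show "w\<^sup>2 * D (Suc k) \<le> D k"
      using L by (simp add: w_def power_divide field_simps)
    have "(\<mu> + L) / L\<^sup>2 * (\<mu>\<^sup>2 * D (Suc k)) \<le> (\<mu> + L) / L\<^sup>2 * (G k \<bullet> G k)"
      using G_ge[OF k] mu L by (intro mult_left_mono) auto
    also have "(\<mu> + L) / L\<^sup>2 * (\<mu>\<^sup>2 * D (Suc k)) = \<mu> * (w + w\<^sup>2) * D (Suc k)"
      using L by (simp add: w_def field_simps power2_eq_square)
    finally show "\<mu> / 2 * (w + w\<^sup>2) * D (Suc k) \<le> F k - F (Suc k)"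
      using F_ge[OF k] by simp
  qed (use w mu in auto)
  moreover have "(\<Sum>j=1..2 * N. w ^ j) = E_sum N (L / \<mu>)"
    by (simp add: E_sum_def w_def power_int_minus power_divide)
  \<comment> \<open>No subgradient of \<open>f2\<close> at \<open>x (Suc N)\<close> has been chosen,
    so only the two lower bounds are used here.\<close>
  moreover have "(\<mu> + m) / 2 * D N \<le> F N - F (Suc N)"
    using f1_lower[of N N] f2_lower[of N "x (Suc N)"]
    by (simp add: F_def D_def d_def norm_minus_commute inner_simps algebra_simps add_divide_distrib)
  ultimately have main: "1 / 2 * D N * (\<mu> + m + \<mu> * E_sum N (L / \<mu>)) \<le> F 0 - F (Suc N)"
    by (simp add: algebra_simps add_divide_distrib)
  have "0 \<le> E_sum N (L / \<mu>)"
    using L mu by (simp add: E_sum_def sum_nonneg)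
  then have pos: "0 < \<mu> + m + \<mu> * E_sum N (L / \<mu>)"
    using mu(1) assms(4) unfolding defs by (intro add_pos_nonneg[OF _ mult_nonneg_nonneg]) simp_all
  have dc: "dc_fun f1 f2 (x k) = ereal (F k)" if "k \<le> Suc N" for k
    using a[OF that] by (simp add: dc_fun_def F_def \<phi>)
  have "1 / 2 * D N \<le> (F 0 - F (Suc N)) / (\<mu> + m + \<mu> * E_sum N (L / \<mu>))"
    using main pos by (simp only: pos_le_divide_eq)
  moreover have "(dc_fun f1 f2 (x 0) - dc_fun f1 f2 (x (N + 1)))
      / ereal (\<mu> + m + \<mu> * E_sum N (L / \<mu>))
    = ereal ((F 0 - F (Suc N)) / (\<mu> + m + \<mu> * E_sum N (L / \<mu>)))"
    using pos by (simp add: dc)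
  ultimately show ?thesis
    unfolding defs[symmetric] by (simp add: D_def d_def)
qed

end
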